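(* For all $n\geq 1$, $\mathrm{dsf}(4n-3)\equiv \mathrm{dsf}(4n+3)\pmod 2$.
   Context: The delayed semi-Fibonacci sequence $\{\mathrm{dsf}(n)\}_{n\ge0}$ is defined recursively by $\mathrm{dsf}(0)=\mathrm{dsf}(1)=\mathrm{dsf}(2)=0$, $\mathrm{dsf}(3)=1$, and for $n\ge2$: $\mathrm{dsf}(2n)=\mathrm{dsf}(n)$ and $\mathrm{dsf}(2n+1)=\mathrm{dsf}(2n)+\mathrm{dsf}(2n-1)$. *)

theory Defs
  imports "HOL-Number_Theory.Cong"
begin

text \<open>The delayed semi-Fibonacci sequence. The recursive clause is split by the parity of the
  index; the lemmas after it recover the two recurrences in the form with indices
  \<open>2 * n\<close> and \<open>2 * n + 1\<close>, for \<open>n \<ge> 2\<close>.\<close>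

fun dsf :: "nat \<Rightarrow> nat" where
  "dsf n =
    (if n \<le> 2 then 0
     else if n = 3 then 1
     else if even n then dsf (n div 2)
     else dsf (n - 1) + dsf (n - 2))"

declare dsf.simps [simp del]

lemma dsf_initial:
  "dsf 0 = 0" "dsf 1 = 0" "dsf 2 = 0" "dsf 3 = 1"
  by (simp_all add: dsf.simps)

lemma dsf_even:
  assumes "n \<ge> 2"
  shows "dsf (2 * n) = dsf n"
  using assms by (subst dsf.simps) (auto simp: dsf.simps)

lemma dsf_odd:
  assumes "n \<ge> 2"
  shows "dsf (2 * n + 1) = dsf (2 * n) + dsf (2 * n - 1)"
proof -
  have "2 * n + 1 - 2 = 2 * n - 1"
    by simp
  with assms show ?thesis
    by (subst dsf.simps) simp
qed

end

theory Submission
  imports Defs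
begin

text \<open>For \<open>n \<ge> 2\<close>, unfolding the odd recurrence three times from \<open>4 * n + 3\<close> down to
  \<open>4 * n - 3\<close> collects the
  even-indexed values at \<open>4 * n + 2\<close>, \<open>4 * n\<close> and \<open>4 * n - 2\<close>. Halving the indices turns their sum
  into \<open>dsf (2 * n + 1) + dsf (2 * n) + dsf (2 * n - 1)\<close>, and by the odd recurrence the last two
  terms again add up to \<open>dsf (2 * n + 1)\<close>. So the two sides differ by the even number
  \<open>2 * dsf (2 * n + 1)\<close>.\<close>

lemma dsf_four_times_plus_three:
  assumes "n \<ge> 1"
  shows "dsf (4 * n + 3) = dsf (4 * n - 3) + 2 * dsf (2 * n + 1)"
proof (cases "n = 1")
  \<comment> \<open>Here the odd recurrence fails at the index \<open>2 * n + 1 = 4 * n - 1 = 3\<close>, where the seed value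
    \<open>dsf 3 = 1\<close> overrides it.\<close>
  case True
  then show ?thesis
    by (simp add: dsf.simps)
next
  case False
  with assms obtain m where n: "n = m + 2"
    using le_Suc_ex[of 2 n] by (auto simp: add.commute)
  have "dsf (4 * m + 11) = dsf (2 * m + 5) + dsf (4 * m + 9)"
    using dsf_odd[of "2 * m + 5"] dsf_even[of "2 * m + 5"] by (simp add: algebra_simps)
  moreover have "dsf (4 * m + 9) = dsf (2 * m + 4) + dsf (4 * m + 7)"
    using dsf_odd[of "2 * m + 4"] dsf_even[of "2 * m + 4"] by (simp add: algebra_simps)
  moreover have "dsf (4 * m + 7) = dsf (2 * m + 3) + dsf (4 * m + 5)"
    using dsf_odd[of "2 * m + 3"] dsf_even[of "2 * m + 3"] by (simp add: algebra_simps)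
  moreover have "dsf (2 * m + 5) = dsf (2 * m + 4) + dsf (2 * m + 3)"
    using dsf_odd[of "m + 2"] by (simp add: algebra_simps eval_nat_numeral)
  ultimately have "dsf (4 * m + 11) = dsf (4 * m + 5) + 2 * dsf (2 * m + 5)"
    by simp
  then show ?thesis
    by (simp add: n algebra_simps eval_nat_numeral)
qed

theorem theorem8p4:
  fixes n :: nat
  assumes "n \<ge> 1"
  shows "[dsf (4 * n - 3) = dsf (4 * n + 3)] (mod 2)"
  using dsf_four_times_plus_three[OF assms] by (simp add: cong_def)

end
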